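(* Let $e \ge 2$ and let $2 \le g_1 < \ldots < g_e$ be integers with $\gcd(g_1,\ldots,g_e)=1$. Let $F$ be the largest integer that is not representable as a linear combination of $g_1,\ldots,g_e$ with coefficients in $\mathbb{N}$, let $n$ be the number of non-negative integers less than $F$ which are representable as a linear combination of $g_1,\ldots,g_e$ with coefficients in $\mathbb{N}$, and let $q=\left\lceil \frac{F+1}{g_1} \right\rceil$. Then (1) $F+1 \le q e n$; (2) $F+1 \le e n^2$.
   Context: $\mathbb{N}$ denotes the set of non-negative integers (including $0$). "Coprime" for $g_1,\ldots,g_e$ means that the greatest common divisor of the whole collection is $1$ (not pairwise coprimality); this guarantees that only finitely many non-negative integers are not representable, so that $F$ (the Frobenius number) exists. *)

theory Defs
  imports Complex_Main
begin

text \<open>Generators are given as a sequence \<open>g 1, \<dots>, g e\<close>; values of \<open>g\<close> outside \<open>{1..e}\<close>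
  are irrelevant.\<close>

definition representable :: "nat \<Rightarrow> (nat \<Rightarrow> int) \<Rightarrow> int \<Rightarrow> bool" where
  "representable e g x \<longleftrightarrow> (\<exists>c :: nat \<Rightarrow> nat. x = (\<Sum>i=1..e. int (c i) * g i))"

text \<open>The greatest element exists whenever the generators are positive with greatest common
  divisor 1 (negative integers are never representable, so it is at least \<open>-1\<close>); otherwise the
  value is unspecified.\<close>

definition frobenius :: "nat \<Rightarrow> (nat \<Rightarrow> int) \<Rightarrow> int" where
  "frobenius e g = (GREATEST x. \<not> representable e g x)"

definition num_below :: "nat \<Rightarrow> (nat \<Rightarrow> int) \<Rightarrow> nat" where
  "num_below e g = card {x. 0 \<le> x \<and> x < frobenius e g \<and> representable e g x}"

end

theory Submission
  imports Defs
begin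

text \<open>
  Write \<open>m = g 1\<close> and call \<open>L\<close> the set of the \<open>n\<close> representable integers below \<open>F\<close>. By definition
  of \<open>q\<close> one has \<open>F + 1 \<le> q * m\<close>, so the first inequality follows from \<open>m \<le> e * n\<close>, that is, from
  a surjection of \<open>L \<times> {1..e}\<close> onto the residues modulo \<open>m\<close>. The map \<open>(l, i) \<mapsto> (l + g i) mod m\<close>
  is one: the least representable number \<open>x \<noteq> 0\<close> of a residue class is \<open>l + g i\<close> with \<open>l\<close>
  representable, and \<open>l\<close> must lie below \<open>F\<close>, since otherwise \<open>x - m \<ge> l > F\<close> would be a smaller
  representable number of the same class (lemma \<open>representable_cong_small_plus_generator\<close>); the
  class of \<open>0\<close> is hit by \<open>0 + g 1\<close>.

  The second inequality follows from the first by \<open>q \<le> n\<close>: the multiples \<open>k * m\<close> with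
  \<open>0 \<le> k < q\<close> are \<open>q\<close> distinct representable numbers that do not exceed \<open>F\<close>, and none of them
  equals \<open>F\<close>.

  All of this presupposes that \<open>F\<close> really is the greatest non-representable integer, which rests
  on Bezout's identity (lemma \<open>eventually_representable\<close>).
\<close>

lemma representable_0: "representable e g 0"
  unfolding representable_def by (rule exI[of _ "\<lambda>_. 0"]) simp

lemma representable_add:
  assumes "representable e g x" "representable e g y"
  shows "representable e g (x + y)"
proof -
  obtain c d :: "nat \<Rightarrow> nat"
    where "x = (\<Sum>i=1..e. int (c i) * g i)" "y = (\<Sum>i=1..e. int (d i) * g i)"
    using assms unfolding representable_def by blast
  then have "x + y = (\<Sum>i=1..e. int (c i + d i) * g i)"
    by (simp add: sum.distrib algebra_simps)
  then show ?thesis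
    unfolding representable_def by (rule exI[of _ "\<lambda>i. c i + d i"])
qed

lemma representable_multiple:
  assumes "i \<in> {1..e}"
  shows "representable e g (int k * g i)"
proof -
  have "(\<Sum>j=1..e. int (if j = i then k else 0) * g j) = (\<Sum>j=1..e. if j = i then int k * g j else 0)"
    by (rule sum.cong) auto
  also have "\<dots> = int k * g i"
    using assms by simp
  finally show ?thesis
    unfolding representable_def by (intro exI[of _ "\<lambda>j. if j = i then k else 0"]) simp
qed

lemma representable_nonneg:
  assumes "\<And>i. i \<in> {1..e} \<Longrightarrow> 0 < g i" "representable e g x"
  shows "0 \<le> x"
  using assms unfolding representable_def by (force intro!: sum_nonneg simp: less_imp_le)

lemma representable_nonzero_split:
  assumes "representable e g x" "x \<noteq> 0"
  obtains l i where "i \<in> {1..e}" "representable e g l" "x = l + g i"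
proof -
  obtain c where c: "x = (\<Sum>i=1..e. int (c i) * g i)"
    using assms(1) unfolding representable_def by blast
  obtain i where i: "i \<in> {1..e}" "c i \<noteq> 0"
    using assms(2) c by (metis (no_types, lifting) mult_zero_left of_nat_0 sum.neutral)
  have "(\<Sum>j=1..e. int ((c(i := c i - 1)) j) * g j)
      = (\<Sum>j=1..e. int (c j) * g j - (if j = i then g j else 0))"
    using i by (intro sum.cong) (auto simp: algebra_simps of_nat_diff)
  also have "\<dots> = x - g i"
    using i(1) by (simp add: sum_subtractf c)
  finally have "representable e g (x - g i)"
    unfolding representable_def by (intro exI[of _ "c(i := c i - 1)"]) simp
  with i(1) show ?thesis
    by (intro that[of i "x - g i"]) auto
qed

lemma bezout_Gcd_image:
  fixes g :: "'a \<Rightarrow> int"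
  assumes "finite I"
  shows "\<exists>u. (\<Sum>i\<in>I. u i * g i) = Gcd (g ` I)"
  using assms
proof induction
  case empty
  then show ?case by simp
next
  case (insert a I)
  then obtain u where u: "(\<Sum>i\<in>I. u i * g i) = Gcd (g ` I)" by blast
  obtain s t where st: "s * g a + t * Gcd (g ` I) = gcd (g a) (Gcd (g ` I))"
    using bezout_int by blast
  have "(\<Sum>i\<in>I. (if i = a then s else t * u i) * g i) = t * (\<Sum>i\<in>I. u i * g i)"
    using insert.hyps unfolding sum_distrib_left by (intro sum.cong) (auto simp: mult.assoc)
  then have "(\<Sum>i\<in>insert a I. (if i = a then s else t * u i) * g i) = Gcd (g ` insert a I)"
    using insert.hyps u st by simp
  then show ?case by (intro exI[of _ "\<lambda>i. if i = a then s else t * u i"])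
qed

text \<open>In Bezout's identity for \<open>N\<close> the coefficients may be reduced modulo \<open>g 1\<close> at the expense of
  the coefficient of \<open>g 1\<close>. The reduced combination is bounded independently of \<open>N\<close>, so for large
  \<open>N\<close> the multiple of \<open>g 1\<close> that completes it to \<open>N\<close> is non-negative.\<close>

lemma eventually_representable:
  assumes pos: "\<And>i. i \<in> {1..e} \<Longrightarrow> 0 < g i"
    and e: "1 \<le> e"
    and coprime: "Gcd (g ` {1..e}) = 1"
  shows "\<exists>B. \<forall>N \<ge> B. representable e g N"
proof (intro exI allI impI)
  fix N :: int
  assume N: "(\<Sum>i=1..e. g 1 * g i) \<le> N"
  have g1: "0 < g 1" using pos e by simp
  obtain u where u: "(\<Sum>i=1..e. u i * g i) = 1"
    using bezout_Gcd_image[of "{1..e}" g] coprime by auto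
  define r where "r = (\<Sum>i=1..e. (N * u i mod g 1) * g i)"
  have "r = (\<Sum>i=1..e. int (nat (N * u i mod g 1)) * g i)"
    unfolding r_def using g1 by simp
  then have rep_r: "representable e g r"
    unfolding representable_def by (rule exI[of _ "\<lambda>i. nat (N * u i mod g 1)"])
  have "N - r = (\<Sum>i=1..e. (N * u i - N * u i mod g 1) * g i)"
    using u by (simp add: r_def left_diff_distrib sum_subtractf mult.assoc flip: sum_distrib_left)
  moreover have "g 1 dvd \<dots>"
    by (intro dvd_sum dvd_mult2 dvd_minus_mod)
  ultimately obtain t where t: "N - r = g 1 * t"
    by (metis dvdE)
  have "r \<le> (\<Sum>i=1..e. g 1 * g i)"
    unfolding r_def using pos g1 by (intro sum_mono mult_right_mono) (auto simp: less_imp_le)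
  with N t have "0 \<le> g 1 * t" by linarith
  with g1 have "0 \<le> t" by (simp add: zero_le_mult_iff)
  then have "N = r + int (nat t) * g 1"
    using t by (simp add: mult.commute)
  then show "representable e g N"
    using representable_add[OF rep_r representable_multiple[of 1 e g "nat t"]] e by simp
qed

text \<open>The hypothesis that no generator is \<open>1\<close> makes \<open>1\<close> non-representable and thus the greatest
  non-representable integer positive.\<close>

lemma frobenius_greatest:
  assumes ge2: "\<And>i. i \<in> {1..e} \<Longrightarrow> 2 \<le> g i"
    and e: "1 \<le> e"
    and coprime: "Gcd (g ` {1..e}) = 1"
  shows "\<not> representable e g (frobenius e g)"
    and "\<And>x. frobenius e g < x \<Longrightarrow> representable e g x"
    and "1 \<le> frobenius e g"
proof -
  have pos: "0 < g i" if "i \<in> {1..e}" for i using ge2[OF that] by simp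
  obtain B where B: "\<And>N. B \<le> N \<Longrightarrow> representable e g N"
    using eventually_representable[of e g] pos e coprime by blast
  have one: "\<not> representable e g 1"
  proof
    assume "representable e g 1"
    then obtain l i where "i \<in> {1..e}" "representable e g l" "1 = l + g i"
      by (rule representable_nonzero_split) auto
    then show False
      using representable_nonneg[of e g l] pos ge2[of i] by auto
  qed
  define G where "G = {x. 1 \<le> x \<and> x \<le> B \<and> \<not> representable e g x}"
  have fin: "finite G"
    by (rule finite_subset[of _ "{1..B}"]) (auto simp: G_def)
  have "1 \<in> G"
    using one B[of 1] by (force simp: G_def)
  then have "Max G \<in> G" and "1 \<le> Max G"
    using fin by (auto intro: Max_in)
  have max: "x \<le> Max G" if "\<not> representable e g x" for x
  proof (cases "1 \<le> x")
    case True
    with that B[of x] have "x \<in> G" by (force simp: G_def)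
    with fin show ?thesis by simp
  qed (use \<open>1 \<le> Max G\<close> in simp)
  have "frobenius e g = Max G"
    unfolding frobenius_def using \<open>Max G \<in> G\<close> max
    by (intro Greatest_equality) (auto simp: G_def)
  with \<open>Max G \<in> G\<close> \<open>1 \<le> Max G\<close> max
  show "\<not> representable e g (frobenius e g)"
    and "\<And>x. frobenius e g < x \<Longrightarrow> representable e g x"
    and "1 \<le> frobenius e g"
    by (auto simp: G_def not_le[symmetric])
qed

text \<open>Descent within a residue class modulo the least generator: a representable number whose
  splitting \<open>l + g i\<close> has \<open>l\<close> above the gap \<open>F\<close> stays representable after subtracting \<open>g 1\<close>,
  because \<open>g 1 \<le> g i\<close> keeps it above \<open>F\<close>.\<close>

lemma representable_cong_small_plus_generator:
  assumes g1: "0 < g 1"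
    and least: "\<And>i. i \<in> {1..e} \<Longrightarrow> g 1 \<le> g i"
    and e: "1 \<le> e"
    and F: "0 < F" "\<not> representable e g F" "\<And>x. F < x \<Longrightarrow> representable e g x"
    and x: "representable e g x"
  shows "\<exists>l i. i \<in> {1..e} \<and> representable e g l \<and> l < F \<and> x mod g 1 = (l + g i) mod g 1"
  using x
proof (induction "nat x" arbitrary: x rule: less_induct)
  case less
  have pos: "0 < g i" if "i \<in> {1..e}" for i using least[OF that] g1 by simp
  show ?case
  proof (cases "x = 0")
    case True
    then show ?thesis
      using e F(1) representable_0[of e g] by (intro exI[of _ 0] exI[of _ 1]) auto
  next
    case False
    with less.prems obtain l i where li: "i \<in> {1..e}" "representable e g l" "x = l + g i"
      by (rule representable_nonzero_split)
    show ?thesis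
    proof (cases "l < F")
      case True
      with li show ?thesis by blast
    next
      case False
      with li(2) F(2) have "F < l" by (metis linorder_neqE)
      with li least[of i] have "F < x - g 1" by force
      with F(3) have "representable e g (x - g 1)" by blast
      moreover have "nat (x - g 1) < nat x"
        using \<open>F < x - g 1\<close> F(1) g1 by linarith
      moreover have "x mod g 1 = (x - g 1) mod g 1" by simp
      ultimately show ?thesis using less.hyps by metis
    qed
  qed
qed

theorem theorem1:
  fixes e n :: nat and g :: "nat \<Rightarrow> int" and F q :: int
  assumes "e \<ge> 2"
    and "2 \<le> g 1"
    and "strict_mono_on {1..e} g"
    and "Gcd (g ` {1..e}) = 1"
    and "F = frobenius e g"
    and "n = num_below e g"
    and "q = \<lceil>real_of_int (F + 1) / real_of_int (g 1)\<rceil>"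
  shows "F + 1 \<le> q * int e * int n \<and> F + 1 \<le> int e * (int n)\<^sup>2"
proof -
  have e: "1 \<le> e" using assms(1) by simp
  have g1: "0 < g 1" using assms(2) by simp
  have least: "g 1 \<le> g i" if "i \<in> {1..e}" for i
    using strict_mono_on_leD[OF assms(3), of 1 i] that by auto
  have ge2: "2 \<le> g i" if "i \<in> {1..e}" for i
    using least[OF that] assms(2) by simp
  have F: "\<not> representable e g F" "\<And>x. F < x \<Longrightarrow> representable e g x" "1 \<le> F"
    unfolding assms(5) using frobenius_greatest[of e g] ge2 e assms(4) by blast+
  define L where "L = {x. 0 \<le> x \<and> x < F \<and> representable e g x}"
  have finL: "finite L"
    by (rule finite_subset[of _ "{0..F}"]) (auto simp: L_def)
  have n: "n = card L"
    by (simp add: assms(5,6) num_below_def L_def)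

  have "{0..<g 1} \<subseteq> (\<lambda>(l, i). (l + g i) mod g 1) ` (L \<times> {1..e})"
  proof
    fix r assume r: "r \<in> {0..<g 1}"
    \<comment> \<open>a member of the class of \<open>r\<close> above \<open>F\<close>\<close>
    define x where "x = r + g 1 * (F + 1)"
    have "1 * (F + 1) \<le> g 1 * (F + 1)"
      using g1 F(3) by (intro mult_right_mono) auto
    with r have "F < x" by (simp add: x_def)
    then have "representable e g x" by (rule F(2))
    then obtain l i where li: "i \<in> {1..e}" "representable e g l" "l < F"
        "x mod g 1 = (l + g i) mod g 1"
      using representable_cong_small_plus_generator[of g e F x] g1 least e F by auto
    have "0 \<le> l"
      using representable_nonneg[OF _ li(2)] ge2 by force
    moreover have "x mod g 1 = r"
      using r by (simp add: x_def)
    ultimately show "r \<in> (\<lambda>(l, i). (l + g i) mod g 1) ` (L \<times> {1..e})"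
      using li by (force simp: L_def)
  qed
  then have "card {0..<g 1} \<le> card (L \<times> {1..e})"
    by (rule surj_card_le[rotated]) (simp add: finL)
  then have m_le: "g 1 \<le> int e * int n"
    by (simp add: n card_cartesian_product mult.commute flip: of_nat_mult)

  have q0: "0 \<le> q"
    using F(3) g1 unfolding assms(7) by (auto simp: zero_le_ceiling intro: less_le_trans[of _ 0])
  have "(\<lambda>k. k * g 1) ` {0..<q} \<subseteq> L"
  proof clarify
    fix k assume k: "k \<in> {0..<q}"
    then have "real_of_int k < real_of_int (F + 1) / real_of_int (g 1)"
      by (simp add: assms(7) less_ceiling_iff)
    then have "real_of_int k * real_of_int (g 1) < real_of_int (F + 1)"
      using g1 by (simp add: pos_less_divide_eq)
    then have "k * g 1 < F + 1"
      by (metis of_int_less_iff of_int_mult)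
    moreover have rep: "representable e g (k * g 1)"
      using representable_multiple[of 1 e g "nat k"] k e by simp
    then have "k * g 1 \<noteq> F" using F(1) by auto
    ultimately show "k * g 1 \<in> L"
      using rep k g1 by (simp add: L_def)
  qed
  moreover have "inj_on (\<lambda>k. k * g 1) {0..<q}"
    using g1 by (auto intro: inj_onI)
  ultimately have "card {0..<q} \<le> card L"
    using finL by (metis card_inj_on_le)
  then have q_le: "q \<le> int n"
    using q0 n by simp

  have "real_of_int (F + 1) / real_of_int (g 1) \<le> real_of_int q"
    by (simp add: assms(7))
  then have "real_of_int (F + 1) \<le> real_of_int q * real_of_int (g 1)"
    using g1 by (simp add: pos_divide_le_eq)
  then have "F + 1 \<le> q * g 1"
    by (metis of_int_le_iff of_int_mult)
  also have "\<dots> \<le> q * (int e * int n)"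
    using m_le q0 by (rule mult_left_mono)
  finally have first: "F + 1 \<le> q * (int e * int n)" .
  also have "\<dots> \<le> int n * (int e * int n)"
    using q_le by (rule mult_right_mono) simp
  finally have "F + 1 \<le> int n * (int e * int n)" .
  with first show ?thesis
    by (simp add: power2_eq_square algebra_simps)
qed

end
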